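(* For every $k\ge 1$, the $k$-snake is both 1-in-degenerate and 1-out-degenerate.
   Context: The $k$-snake is the tournament on vertices $v_1,\dots,v_k$ such that, with respect to the ordering $(v_1,\dots,v_k)$, the backedge graph has edge set $\{v_iv_{i+1}: i\in[k-1]\}$; here an arc $v_i\to v_j$ is a backedge if $i>j$, and the backedge graph is the undirected graph whose edges are the pairs $v_iv_j$ with $(v_i,v_j)$ a backedge. Thus $v_{i+1}\to v_i$ for all $i\in[k-1]$ and $v_i\to v_j$ whenever $j\ge i+2$. A tournament is 1-out-degenerate (resp. 1-in-degenerate) if every (nonempty) subtournament has a vertex of out-degree (resp. in-degree) at most $1$ within that subtournament. *)

theory Defs
  imports "Graph_Theory.Digraph_Component"
begin

locale tournament = digraph +
  assumes exactly_one_arc: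
    "\<lbrakk>u \<in> verts G; v \<in> verts G; u \<noteq> v\<rbrakk> \<Longrightarrow> u \<rightarrow>\<^bsub>G\<^esub> v \<longleftrightarrow> \<not> v \<rightarrow>\<^bsub>G\<^esub> u"

definition vertex_ordering :: "('a, 'b) pre_digraph \<Rightarrow> 'a list \<Rightarrow> bool" where
  "vertex_ordering T vs \<longleftrightarrow> distinct vs \<and> set vs = verts T"

definition backedge_graph :: "('a, 'b) pre_digraph \<Rightarrow> 'a list \<Rightarrow> 'a set set" where
  "backedge_graph T vs = {{vs ! i, vs ! j} | i j. j < i \<and> i < length vs \<and> vs ! i \<rightarrow>\<^bsub>T\<^esub> vs ! j}"

text \<open>Being a \<open>k\<close>-snake is a property of \<open>T\<close>, with arbitrary vertex and arc types;
  list positions start at \<open>0\<close>, so \<open>vs ! i\<close> is the vertex with index \<open>i + 1\<close>.\<close>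

definition k_snake :: "nat \<Rightarrow> ('a, 'b) pre_digraph \<Rightarrow> bool" where
  "k_snake k T \<longleftrightarrow> tournament T \<and>
     (\<exists>vs. vertex_ordering T vs \<and> length vs = k \<and>
        backedge_graph T vs = {{vs ! i, vs ! Suc i} | i. Suc i < k})"

text \<open>The subtournaments of a tournament are exactly its induced subgraphs.\<close>

definition out_degenerate :: "nat \<Rightarrow> ('a, 'b) pre_digraph \<Rightarrow> bool" where
  "out_degenerate d T \<longleftrightarrow>
     (\<forall>H. induced_subgraph H T \<and> verts H \<noteq> {} \<longrightarrow> (\<exists>v \<in> verts H. out_degree H v \<le> d))"

definition in_degenerate :: "nat \<Rightarrow> ('a, 'b) pre_digraph \<Rightarrow> bool" where
  "in_degenerate d T \<longleftrightarrow>
     (\<forall>H. induced_subgraph H T \<and> verts H \<noteq> {} \<longrightarrow> (\<exists>v \<in> verts H. in_degree H v \<le> d))"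

lemma backedge_graph_iff:
  assumes "distinct vs" "j < i" "i < length vs"
  shows "{vs ! i, vs ! j} \<in> backedge_graph T vs \<longleftrightarrow> vs ! i \<rightarrow>\<^bsub>T\<^esub> vs ! j"
proof
  assume "{vs ! i, vs ! j} \<in> backedge_graph T vs"
  then obtain a b where ab: "{vs ! i, vs ! j} = {vs ! a, vs ! b}" "b < a" "a < length vs"
    "vs ! a \<rightarrow>\<^bsub>T\<^esub> vs ! b"
    unfolding backedge_graph_def by blast
  then have "i = a \<and> j = b"
    using assms by (auto simp: doubleton_eq_iff nth_eq_iff_index_eq)
  with ab show "vs ! i \<rightarrow>\<^bsub>T\<^esub> vs ! j" by simp
qed (use assms in \<open>auto simp: backedge_graph_def\<close>)

lemma snake_backedges_iff:
  assumes "distinct vs" "j < i" "i < length vs"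
  shows "{vs ! i, vs ! j} \<in> {{vs ! l, vs ! Suc l} | l. Suc l < length vs} \<longleftrightarrow> i = Suc j"
  using assms by (auto simp: doubleton_eq_iff nth_eq_iff_index_eq insert_commute)

text \<open>The ordering determines all arcs of a \<open>k\<close>-snake, so any two \<open>k\<close>-snakes are isomorphic.\<close>

lemma k_snake_arcs:
  assumes "k_snake k T"
  obtains vs where "vertex_ordering T vs" "length vs = k"
    "\<And>i j. \<lbrakk>i < k; j < k\<rbrakk> \<Longrightarrow> vs ! i \<rightarrow>\<^bsub>T\<^esub> vs ! j \<longleftrightarrow> i = Suc j \<or> Suc (Suc i) \<le> j"
proof -
  from assms obtain vs where T: "tournament T" and vs: "distinct vs" "set vs = verts T" "length vs = k"
    and ord: "vertex_ordering T vs"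
    and B: "backedge_graph T vs = {{vs ! i, vs ! Suc i} | i. Suc i < length vs}"
    unfolding k_snake_def vertex_ordering_def by blast
  interpret tournament T by (rule T)
  have backw: "vs ! i \<rightarrow>\<^bsub>T\<^esub> vs ! j \<longleftrightarrow> i = Suc j" if "j < i" "i < k" for i j
    using backedge_graph_iff[of vs j i T] snake_backedges_iff[of vs j i] that vs B by simp
  have "vs ! i \<rightarrow>\<^bsub>T\<^esub> vs ! j \<longleftrightarrow> i = Suc j \<or> Suc (Suc i) \<le> j" if "i < k" "j < k" for i j
  proof -
    consider "j < i" | "i = j" | "i < j" by linarith
    then show ?thesis
    proof cases
      case 1 then show ?thesis using backw that by auto
    next
      case 2 then show ?thesis using adj_not_same by auto
    next
      case 3
      then have "vs ! i \<rightarrow>\<^bsub>T\<^esub> vs ! j \<longleftrightarrow> \<not> vs ! j \<rightarrow>\<^bsub>T\<^esub> vs ! i"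
        using exactly_one_arc[of "vs ! i" "vs ! j"] that vs by (metis nth_eq_iff_index_eq nth_mem less_irrefl)
      then show ?thesis using backw[OF 3] that 3 by auto
    qed
  qed
  with ord vs(3) show ?thesis by (rule that)
qed

lemma k_snake_exists: "\<exists>T :: (nat, nat \<times> nat) pre_digraph. k_snake k T"
proof -
  define T :: "(nat, nat \<times> nat) pre_digraph" where
    "T = \<lparr>verts = {..<k}, arcs = {(i, j). i < k \<and> j < k \<and> (i = Suc j \<or> Suc (Suc i) \<le> j)},
          tail = fst, head = snd\<rparr>"
  have E: "arcs_ends T = {(i, j). i < k \<and> j < k \<and> (i = Suc j \<or> Suc (Suc i) \<le> j)}"
    by (force simp: T_def arcs_ends_conv)
  have fin: "finite (arcs T)"
    by (rule finite_subset[of _ "{..<k} \<times> {..<k}"]) (auto simp: T_def)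
  have "tournament T"
  proof
    show "finite (arcs T)" by (rule fin)
    show "u \<rightarrow>\<^bsub>T\<^esub> v \<longleftrightarrow> \<not> v \<rightarrow>\<^bsub>T\<^esub> u" if "u \<in> verts T" "v \<in> verts T" "u \<noteq> v" for u v
      using that unfolding E by (auto simp: T_def)
  qed (auto simp: T_def arc_to_ends_def)
  moreover have "vertex_ordering T [0..<k]"
    by (auto simp: vertex_ordering_def T_def)
  moreover have "backedge_graph T [0..<k] = {{[0..<k] ! i, [0..<k] ! Suc i} | i. Suc i < k}"
  proof -
    have "backedge_graph T [0..<k] = {{i, j} | i j. j < i \<and> i < k \<and> i = Suc j}"
      unfolding backedge_graph_def E by (intro Collect_cong ex_cong1) auto
    also have "\<dots> = {{i, Suc i} | i. Suc i < k}"
      by (intro Collect_cong) (auto simp: insert_commute)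
    also have "\<dots> = {{[0..<k] ! i, [0..<k] ! Suc i} | i. Suc i < k}"
      by (intro Collect_cong ex_cong1) auto
    finally show ?thesis .
  qed
  ultimately show ?thesis
    unfolding k_snake_def by (intro exI[of _ T] conjI exI[of _ "[0..<k]"]) auto
qed

end

theory Submission
  imports Defs
begin

text \<open>In a subtournament of the snake, the first vertex \<open>v\<^sub>i\<close> (with respect to the snake ordering)
  can only have \<open>v\<^sub>i\<^sub>+\<^sub>1\<close> as an in-neighbour, and the last vertex \<open>v\<^sub>i\<close> can only have
  \<open>v\<^sub>i\<^sub>-\<^sub>1\<close> as an out-neighbour.\<close>

text \<open>\<open>in_degree\<close> counts arcs, not neighbours. Without parallel arcs, an arc into
  \<open>v\<close> is determined by its tail, so a single possible tail \<open>w\<close> leaves at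
  most one arc.\<close>

lemma (in digraph) in_degree_le_one:
  assumes "\<And>u. u \<rightarrow>\<^bsub>G\<^esub> v \<Longrightarrow> u = w"
  shows "in_degree G v \<le> 1"
proof -
  have "a = b" if "a \<in> in_arcs G v" "b \<in> in_arcs G v" for a b
  proof -
    have "tail G a = w" "tail G b = w"
      using that by (auto intro!: assms dest: in_arcs_imp_in_arcs_ends)
    then show ?thesis
      using that by (intro no_multi_arcs) (auto simp: arc_to_ends_def)
  qed
  then show ?thesis
    using card_le_Suc0_iff_eq[OF finite_in_arcs] by (simp add: in_degree_def)
qed

lemma (in digraph) out_degree_le_one:
  assumes "\<And>u. v \<rightarrow>\<^bsub>G\<^esub> u \<Longrightarrow> u = w"
  shows "out_degree G v \<le> 1"
proof -
  have "a = b" if "a \<in> out_arcs G v" "b \<in> out_arcs G v" for a b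
  proof -
    have "head G a = w" "head G b = w"
      using that by (auto intro!: assms dest: in_arcs_imp_in_arcs_ends)
    then show ?thesis
      using that by (intro no_multi_arcs) (auto simp: arc_to_ends_def)
  qed
  then show ?thesis
    using card_le_Suc0_iff_eq[OF finite_out_arcs] by (simp add: out_degree_def)
qed

lemma k_snake_induced_subgraph_degrees:
  assumes snake: "k_snake k T" and ind: "induced_subgraph H T" and ne: "verts H \<noteq> {}"
  shows "(\<exists>v \<in> verts H. in_degree H v \<le> 1) \<and> (\<exists>v \<in> verts H. out_degree H v \<le> 1)"
proof -
  interpret T: tournament T
    using snake by (simp add: k_snake_def)
  interpret H: digraph H
    using ind by (rule T.digraphI_induced)
  obtain vs where ord: "vertex_ordering T vs" and len: "length vs = k"
    and arc: "\<And>i j. \<lbrakk>i < k; j < k\<rbrakk> \<Longrightarrow> vs ! i \<rightarrow>\<^bsub>T\<^esub> vs ! j \<longleftrightarrow> i = Suc j \<or> Suc (Suc i) \<le> j"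
    using k_snake_arcs[OF snake] by blast
  have sub: "subgraph H T"
    using ind by auto
  \<comment> \<open>Degrees in \<open>H\<close> are bounded from above, so arcs of \<open>H\<close>
    are carried over to \<open>T\<close>, where \<open>arc\<close> describes them.\<close>
  have arcH: "u \<rightarrow>\<^bsub>T\<^esub> v" if "u \<rightarrow>\<^bsub>H\<^esub> v" for u v
    using sub that by (rule T.adj_mono[rotated])
  have vertH: "\<exists>i<k. v = vs ! i" if "v \<in> verts H" for v
    using sub that ord len by (metis in_set_conv_nth subgraphE subsetD vertex_ordering_def)
  \<comment> \<open>Positions occupied by \<open>H\<close>; \<open>Min I\<close> and
    \<open>Max I\<close> locate its first and last vertex.\<close>
  define I where "I = {i. i < k \<and> vs ! i \<in> verts H}"
  have fin: "finite I" and Ine: "I \<noteq> {}"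
    using ne vertH by (auto simp: I_def)
  have "in_degree H (vs ! Min I) \<le> 1"
  proof (rule H.in_degree_le_one)
    fix u assume u: "u \<rightarrow>\<^bsub>H\<^esub> vs ! Min I"
    then obtain j where j: "j < k" "u = vs ! j"
      using vertH H.adj_in_verts(1) by blast
    then have "j \<in> I"
      using u H.adj_in_verts(1) by (auto simp: I_def)
    then have "Min I \<le> j"
      using fin by simp
    \<comment> \<open>A forward arc would need \<open>Suc (Suc j) \<le> Min I\<close>, against
      minimality; the backedge case \<open>j = Suc (Min I)\<close> remains.\<close>
    then show "u = vs ! Suc (Min I)"
      using arc[of j "Min I"] arcH[OF u] j by auto
  qed
  moreover have "out_degree H (vs ! Max I) \<le> 1"
  proof (rule H.out_degree_le_one)
    fix u assume u: "vs ! Max I \<rightarrow>\<^bsub>H\<^esub> u"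
    then obtain j where j: "j < k" "u = vs ! j"
      using vertH H.adj_in_verts(2) by blast
    then have "j \<in> I"
      using u H.adj_in_verts(2) by (auto simp: I_def)
    then have "j \<le> Max I"
      using fin by simp
    moreover have "Max I < k"
      using Max_in[OF fin Ine] by (simp add: I_def)
    \<comment> \<open>Maximality excludes a forward arc, so \<open>Max I = Suc j\<close>. If
      \<open>Max I = 0\<close>, no such \<open>u\<close> exists and the truncated index is only a
      dummy.\<close>
    ultimately show "u = vs ! (Max I - 1)"
      using arc[of "Max I" j] arcH[OF u] j by auto
  qed
  moreover have "vs ! Min I \<in> verts H" "vs ! Max I \<in> verts H"
    using Min_in[OF fin Ine] Max_in[OF fin Ine] by (auto simp: I_def)
  ultimately show ?thesis
    by blast
qed

theorem theorem3p2p2: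
  fixes k :: nat and T :: "('a, 'b) pre_digraph"
  assumes "k \<ge> 1" and "k_snake k T"
  shows "in_degenerate 1 T \<and> out_degenerate 1 T"
  using k_snake_induced_subgraph_degrees[OF assms(2)]
  by (simp add: in_degenerate_def out_degenerate_def)

end
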